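(* Let $U\subseteq\mathbb R^p$ be open, let $M_L,M_U:U\to\mathbb R^{m\times N}$ and $y_L,y_U:U\to\mathbb R^m$ be continuously differentiable, let $R:U\to\mathbb R$ be differentiable and $\mu\ge0$, and assume $M_L(\theta)$ and $M_U(\theta)$ have full column rank for all $\theta\in U$. Define $$f_U(w,\theta)=\tfrac12\|M_U(\theta)w-y_U(\theta)\|^2+\tfrac{\mu}{2}R(\theta),\qquad f_L(w,\theta)=\tfrac12\|M_L(\theta)w-y_L(\theta)\|^2,$$ $\widehat w(\theta)=\arg\min_{w\in\mathbb R^N}f_L(w,\theta)=M_L(\theta)^+y_L(\theta)$, and $\widehat f_U(\theta)=f_U(\widehat w(\theta),\theta)$. Then $\widehat f_U$ is differentiable on $U$ and, with $\Gamma(\theta):=M_U(\theta)\big(M_L(\theta)^\top M_L(\theta)\big)^{-1}$, for every $\theta\in U$, $$\nabla\widehat f_U(\theta)=\nabla_\theta f_U\big|_{(\widehat w(\theta),\theta)}-\nabla^2_{\theta w}f_L\big|_{(\widehat w(\theta),\theta)}\,\Gamma(\theta)^\top\big[M_U(\theta)M_L(\theta)^+y_L(\theta)-y_U(\theta)\big].$$ In the special case $M_L=M_U$ and $y_L=y_U$, one has $\Gamma^\top[M_UM_L^+y_L-y_U]=0$, and hence $\nabla\widehat f_U(\theta)=\nabla_\theta f_U|_{(\widehat w(\theta),\theta)}$.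
   Context: Norms are Euclidean. $Z^+=(Z^\top Z)^{-1}Z^\top$ is the Moore–Penrose pseudoinverse of a full column-rank matrix $Z$. $\nabla_\theta f_U|_{(w,\theta)}\in\mathbb R^p$ is the partial gradient with respect to $\theta$ with $w$ held fixed. $\nabla^2_{\theta w}f_L\in\mathbb R^{p\times N}$ is the matrix of mixed second derivatives with $(i,j)$ entry $\partial_{\theta_i}\partial_{w_j}f_L$, i.e. $\nabla^2_{\theta w}f_L[v]=\nabla_\theta\langle\nabla_wf_L(w,\theta),v\rangle$ for $v\in\mathbb R^N$. *)

theory Defs
  imports "HOL-Analysis.Analysis"
begin

definition continuously_differentiable_on ::
  "'a set \<Rightarrow> ('a::real_normed_vector \<Rightarrow> 'b::real_normed_vector) \<Rightarrow> bool" where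
  "continuously_differentiable_on U f \<longleftrightarrow>
     (\<exists>f' :: 'a \<Rightarrow> 'a \<Rightarrow>\<^sub>L 'b.
        (\<forall>x\<in>U. (f has_derivative blinfun_apply (f' x)) (at x)) \<and> continuous_on U f')"

definition gradient :: "('a::real_inner \<Rightarrow> real) \<Rightarrow> 'a \<Rightarrow> 'a" where
  "gradient f x = (THE D. GDERIV f x :> D)"

lemma gradient_eqI: "gradient f x = D" if D: "GDERIV f x :> D"
  unfolding gradient_def
proof (rule the_equality)
  fix E assume "GDERIV f x :> E"
  with D have "(\<lambda>h. inner h E) = (\<lambda>h. inner h D)"
    unfolding gderiv_def by (rule has_derivative_unique[rotated])
  then have "inner (E - D) (E - D) = 0"
    by (metis inner_diff_right right_minus_eq)
  then show "E = D" by simp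
qed (fact D)

definition partial_deriv :: "'n::finite \<Rightarrow> (real^'n \<Rightarrow> real) \<Rightarrow> real^'n \<Rightarrow> real" where
  "partial_deriv i f x = deriv (\<lambda>t. f (x + t *\<^sub>R axis i 1)) 0"

text \<open>The matrix with entry $\partial_{\theta_i}\partial_{w_j} f$ in row $i$, column $j$
  (differentiating in $w$ first).\<close>

definition mixed_hessian ::
  "(real^'n::finite \<Rightarrow> real^'p::finite \<Rightarrow> real) \<Rightarrow> real^'n \<Rightarrow> real^'p \<Rightarrow> real^'n^'p" where
  "mixed_hessian f w \<theta> =
     (\<chi> i j. partial_deriv i (\<lambda>\<theta>'. partial_deriv j (\<lambda>w'. f w' \<theta>') w) \<theta>)"

definition full_column_rank :: "real^'n::finite^'m::finite \<Rightarrow> bool" where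
  "full_column_rank Z \<longleftrightarrow> rank Z = CARD('n)"

text \<open>The Moore--Penrose pseudoinverse by the formula valid for full column rank;
  not meaningful for other matrices.\<close>

definition pinv :: "real^'n::finite^'m::finite \<Rightarrow> real^'m^'n" where
  "pinv Z = matrix_inv (transpose Z ** Z) ** transpose Z"

definition f_lower ::
  "(real^'p::finite \<Rightarrow> real^'n::finite^'m::finite) \<Rightarrow> (real^'p \<Rightarrow> real^'m) \<Rightarrow>
   real^'n \<Rightarrow> real^'p \<Rightarrow> real" where
  "f_lower M y w \<theta> = 1/2 * (norm (M \<theta> *v w - y \<theta>))\<^sup>2"

definition f_upper ::
  "(real^'p::finite \<Rightarrow> real^'n::finite^'m::finite) \<Rightarrow> (real^'p \<Rightarrow> real^'m) \<Rightarrow>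
   real \<Rightarrow> (real^'p \<Rightarrow> real) \<Rightarrow> real^'n \<Rightarrow> real^'p \<Rightarrow> real" where
  "f_upper M y \<mu> R w \<theta> = 1/2 * (norm (M \<theta> *v w - y \<theta>))\<^sup>2 + \<mu>/2 * R \<theta>"

definition w_hat ::
  "(real^'p::finite \<Rightarrow> real^'n::finite^'m::finite) \<Rightarrow> (real^'p \<Rightarrow> real^'m) \<Rightarrow>
   real^'p \<Rightarrow> real^'n" where
  "w_hat M\<^sub>L y\<^sub>L \<theta> = arg_min (\<lambda>w. f_lower M\<^sub>L y\<^sub>L w \<theta>) (\<lambda>_. True)"

definition f_hat ::
  "(real^'p::finite \<Rightarrow> real^'n::finite^'m::finite) \<Rightarrow> (real^'p \<Rightarrow> real^'m) \<Rightarrow>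
   (real^'p \<Rightarrow> real^'n^'m) \<Rightarrow> (real^'p \<Rightarrow> real^'m) \<Rightarrow>
   real \<Rightarrow> (real^'p \<Rightarrow> real) \<Rightarrow> real^'p \<Rightarrow> real" where
  "f_hat M\<^sub>L y\<^sub>L M\<^sub>U y\<^sub>U \<mu> R \<theta> = f_upper M\<^sub>U y\<^sub>U \<mu> R (w_hat M\<^sub>L y\<^sub>L \<theta>) \<theta>"

definition Gamma_mat ::
  "(real^'p::finite \<Rightarrow> real^'n::finite^'m::finite) \<Rightarrow> (real^'p \<Rightarrow> real^'n^'m) \<Rightarrow>
   real^'p \<Rightarrow> real^'n^'m" where
  "Gamma_mat M\<^sub>L M\<^sub>U \<theta> = M\<^sub>U \<theta> ** matrix_inv (transpose (M\<^sub>L \<theta>) ** M\<^sub>L \<theta>)"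

end

theory Submission
  imports Defs
begin

text \<open>Full column rank makes the Gram matrix of \<open>M\<^sub>L\<close> invertible, so the
  lower-level minimizer w is the unique solution of the normal equation \<open>M\<^sub>L\<close>^T
  (\<open>M\<^sub>L\<close> w - \<open>y\<^sub>L\<close>) = 0 (\<open>normal_equation\<close>,
  \<open>is_arg_min_f_lower_iff\<close>), and by Cramer's rule it depends differentiably on
  \<theta>. Let w' be its derivative and r = \<open>M\<^sub>U\<close> w - \<open>y\<^sub>U\<close>
  the upper residual. By the chain rule, the derivative of \<open>f_hat\<close> in direction h is
  the partial derivative of \<open>f_upper\<close> with w held fixed, plus r .
  \<open>M\<^sub>U\<close> w' h. To eliminate w', pair the normal equation with a fixed vector v and
  differentiate. The terms containing derivatives of \<open>M\<^sub>L\<close> and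
  \<open>y\<^sub>L\<close> add up to h . H v with H the mixed Hessian of \<open>f_lower\<close>,
  whence h . H v = - (\<open>M\<^sub>L\<close> v) . (\<open>M\<^sub>L\<close> w' h)
  (\<open>w_hat_has_derivative\<close>). The choice v = \<Gamma>^T r solves
  \<open>M\<^sub>L\<close>^T \<open>M\<^sub>L\<close> v = \<open>M\<^sub>U\<close>^T r
  (\<open>gram_mult_transpose_Gamma\<close>) and turns the extra term into - h . H v. When both
  levels share their data, \<Gamma>^T r vanishes by the normal equation.\<close>

section \<open>Linear least squares: Gram matrix, normal equation, unique minimizer\<close>

lemma inner_matrix_vector_mult:
  fixes A :: "real^'n^'m"
  shows "inner (A *v x) y = inner x (transpose A *v y)"
  by (metis dot_lmul_matrix transpose_matrix_vector transpose_transpose)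

lemma bounded_bilinear_matrix_vector_mult:
  "bounded_bilinear ((*v) :: real^'n^'m \<Rightarrow> real^'n \<Rightarrow> real^'m)"
  unfolding bilinear_conv_bounded_bilinear[symmetric] bilinear_def
  by (auto intro!: linearI simp: matrix_vector_right_distrib matrix_vector_mult_add_rdistrib
      scaleR_matrix_vector_assoc matrix_vector_mult_scaleR)

lemmas has_derivative_matrix_vector_mult =
  bounded_bilinear.FDERIV[OF bounded_bilinear_matrix_vector_mult]

lemma matrix_inv_mult:
  fixes A :: "real^'n^'n"
  assumes "invertible A"
  shows "A ** matrix_inv A = mat 1" "matrix_inv A ** A = mat 1"
  using someI_ex[OF assms[unfolded invertible_def]] by (auto simp: matrix_inv_def)

text \<open>Since x . A^T A x = |A x|^2, the Gram matrix has the same kernel as \<open>A\<close>,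
  which is trivial by full column rank.\<close>

lemma invertible_gram:
  fixes A :: "real^'n^'m"
  assumes "full_column_rank A"
  shows "invertible (transpose A ** A)"
proof -
  have inj: "inj ((*v) A)"
    using assms by (simp add: full_column_rank_def full_rank_injective)
  have "x = 0" if "(transpose A ** A) *v x = 0" for x
  proof -
    have "inner (A *v x) (A *v x) = inner x ((transpose A ** A) *v x)"
      by (simp add: inner_matrix_vector_mult flip: matrix_vector_mul_assoc)
    with that have "A *v x = A *v 0" by simp
    with inj show "x = 0" by (rule injD)
  qed
  then have "inj ((*v) (transpose A ** A))"
    by (simp add: vec.inj_iff_eq_0)
  then show ?thesis
    by (simp add: invertible_left_inverse matrix_left_invertible_injective)
qed

lemma normal_equation:
  fixes A :: "real^'n^'m"
  assumes "full_column_rank A"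
  shows "(transpose A ** A) *v (pinv A *v y) = transpose A *v y"
    and "transpose A *v (A *v (pinv A *v y) - y) = 0"
proof -
  show *: "(transpose A ** A) *v (pinv A *v y) = transpose A *v y"
    using matrix_inv_mult(1)[OF invertible_gram[OF assms]]
    by (metis matrix_vector_mul_assoc matrix_vector_mul_lid pinv_def)
  have "transpose A *v (A *v w - y) = (transpose A ** A) *v w - transpose A *v y" for w
    by (simp only: matrix_vector_mult_diff_distrib matrix_vector_mul_assoc)
  with * show "transpose A *v (A *v (pinv A *v y) - y) = 0"
    by simp
qed

text \<open>Pythagoras: the residual at the pseudoinverse solution is orthogonal to the column space
  of \<open>M \<theta>\<close>, so moving away from that solution costs exactly the squared length
  of the displacement's image.\<close>

lemma f_lower_pinv:
  assumes "full_column_rank (M \<theta>)"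
  shows "f_lower M y w \<theta> = f_lower M y (pinv (M \<theta>) *v y \<theta>) \<theta>
    + 1/2 * (norm (M \<theta> *v (w - pinv (M \<theta>) *v y \<theta>)))\<^sup>2"
proof -
  define w0 where "w0 = pinv (M \<theta>) *v y \<theta>"
  define r where "r = M \<theta> *v w0 - y \<theta>"
  have "M \<theta> *v w - y \<theta> = M \<theta> *v (w - w0) + r"
    by (simp add: r_def matrix_vector_mult_diff_distrib)
  moreover have "inner (M \<theta> *v (w - w0)) r = 0"
    using normal_equation(2)[OF assms] by (simp add: inner_matrix_vector_mult r_def w0_def)
  ultimately have "(norm (M \<theta> *v w - y \<theta>))\<^sup>2 = (norm (M \<theta> *v (w - w0)))\<^sup>2 + (norm r)\<^sup>2"
    by (simp add: norm_add_Pythagorean orthogonal_def)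
  then show ?thesis
    by (simp add: f_lower_def r_def w0_def)
qed

text \<open>The excess over the value at the pseudoinverse solution is the quadratic
  \<open>q\<close>, which is zero there and positive elsewhere because \<open>M \<theta>\<close> is
  injective.\<close>

lemma is_arg_min_f_lower_iff:
  assumes "full_column_rank (M \<theta>)"
  shows "is_arg_min (\<lambda>w. f_lower M y w \<theta>) (\<lambda>_. True) w \<longleftrightarrow> w = pinv (M \<theta>) *v y \<theta>"
proof -
  define w0 where "w0 = pinv (M \<theta>) *v y \<theta>"
  define q where "q = (\<lambda>w. 1/2 * (norm (M \<theta> *v (w - w0)))\<^sup>2)"
  have "f_lower M y v \<theta> = f_lower M y w0 \<theta> + q v" for v
    unfolding w0_def q_def by (rule f_lower_pinv[where M = M and \<theta> = \<theta>, OF assms])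
  then have le_iff: "f_lower M y v \<theta> \<le> f_lower M y v' \<theta> \<longleftrightarrow> q v \<le> q v'" for v v'
    by (metis add_le_cancel_left)
  have inj: "inj ((*v) (M \<theta>))"
    using assms by (simp add: full_column_rank_def full_rank_injective)
  have pos: "q v > 0" if "v \<noteq> w0" for v
    using injD[OF inj, of "v - w0" 0] that by (auto simp: q_def)
  have "is_arg_min (\<lambda>w. f_lower M y w \<theta>) (\<lambda>_. True) w \<longleftrightarrow> (\<forall>v. q w \<le> q v)"
    by (simp add: is_arg_min_def not_less le_iff)
  also have "\<dots> \<longleftrightarrow> w = w0"
  proof
    assume "\<forall>v. q w \<le> q v"
    then have "q w \<le> q w0" ..
    then show "w = w0" using pos[of w] by (auto simp: q_def)
  qed (simp add: q_def)
  finally show ?thesis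
    by (simp add: w0_def)
qed

text \<open>\<open>arg_min\<close> is a choice operator; uniqueness of the minimizer is what
  determines its value.\<close>

lemma w_hat_eq_pinv:
  assumes "full_column_rank (M \<theta>)"
  shows "w_hat M y \<theta> = pinv (M \<theta>) *v y \<theta>"
  unfolding w_hat_def arg_min_def is_arg_min_f_lower_iff[where M = M and \<theta> = \<theta>, OF assms] by simp

section \<open>Differentiability of solutions of parametrized linear systems\<close>

text \<open>Used for vectors and, applied twice, for matrices: it passes between a map and its
  scalar entries, in which Cramer's formula is written.\<close>

lemma differentiable_cart_iff:
  fixes f :: "'a::real_normed_vector \<Rightarrow> 'b::euclidean_space^'n"
  shows "f differentiable (at x within S) \<longleftrightarrow> (\<forall>i. (\<lambda>x. f x $ i) differentiable (at x within S))"
proof (intro iffI allI)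
  fix i assume "f differentiable (at x within S)"
  then obtain f' where "(f has_derivative f') (at x within S)"
    unfolding differentiable_def by (rule exE)
  from bounded_linear.has_derivative[OF bounded_linear_vec_nth this]
  show "(\<lambda>x. f x $ i) differentiable (at x within S)"
    by (rule differentiableI)
next
  assume diff: "\<forall>i. (\<lambda>x. f x $ i) differentiable (at x within S)"
  define f' where "f' = (\<lambda>i. frechet_derivative (\<lambda>x. f x $ i) (at x within S))"
  have f': "((\<lambda>x. f x $ i) has_derivative f' i) (at x within S)" for i
    unfolding f'_def by (rule frechet_derivative_works[THEN iffD1, OF diff[rule_format]])
  have "(f has_derivative (\<lambda>h. \<chi> i. f' i h)) (at x within S)"
  proof (subst has_derivative_componentwise_within, rule ballI)
    fix b :: "'b^'n" assume "b \<in> Basis"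
    then obtain i u where b: "b = axis i u"
      by (auto simp: Basis_vec_def)
    show "((\<lambda>x. inner (f x) b) has_derivative (\<lambda>h. inner (\<chi> i. f' i h) b)) (at x within S)"
      unfolding b inner_axis vec_lambda_beta by (rule has_derivative_inner_left[OF f'])
  qed
  then show "f differentiable (at x within S)"
    by (rule differentiableI)
qed

lemma differentiable_prod:
  fixes f :: "'i \<Rightarrow> 'a::real_normed_vector \<Rightarrow> 'b::real_normed_field"
  assumes "\<And>i. i \<in> I \<Longrightarrow> f i differentiable (at x within S)"
  shows "(\<lambda>x. \<Prod>i\<in>I. f i x) differentiable (at x within S)"
proof -
  have "(f i has_derivative frechet_derivative (f i) (at x within S)) (at x within S)"
    if "i \<in> I" for i
    using assms[OF that] by (simp flip: frechet_derivative_works)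
  from has_derivative_prod[of I f, OF this] show ?thesis
    by (rule differentiableI)
qed

lemma differentiable_det:
  fixes A :: "'a::real_normed_vector \<Rightarrow> real^'n^'n"
  assumes "\<And>i j. (\<lambda>x. A x $ i $ j) differentiable (at x within S)"
  shows "(\<lambda>x. det (A x)) differentiable (at x within S)"
  unfolding det_def
  by (intro differentiable_sum ballI differentiable_mult differentiable_const differentiable_prod
      assms) (simp add: finite_permutations)

text \<open>By Cramer's rule the solution is a rational function of the coefficients.\<close>

lemma differentiable_linear_system_solution:
  fixes G :: "'a::real_normed_vector \<Rightarrow> real^'n^'n" and b w :: "'a \<Rightarrow> real^'n"
  assumes "open U" "x \<in> U"
    and G: "\<And>i j. (\<lambda>x. G x $ i $ j) differentiable (at x)"
    and b: "\<And>i. (\<lambda>x. b x $ i) differentiable (at x)"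
    and inv: "\<And>y. y \<in> U \<Longrightarrow> invertible (G y)"
    and sol: "\<And>y. y \<in> U \<Longrightarrow> G y *v w y = b y"
  shows "w differentiable (at x)"
proof -
  define c where "c = (\<lambda>y. \<chi> k. det (\<chi> i j. if j = k then b y $ i else G y $ i $ j) / det (G y))"
  have "(\<lambda>y. if j = k then b y $ i else G y $ i $ j) differentiable (at x)" for i j k
    by (cases "j = k") (auto simp: G b)
  then have "(\<lambda>y. det (\<chi> i j. if j = k then b y $ i else G y $ i $ j)) differentiable (at x)" for k
    by (intro differentiable_det) simp
  moreover have "(\<lambda>y. det (G y)) differentiable (at x)"
    by (intro differentiable_det G)
  ultimately have "c differentiable (at x)"
    unfolding differentiable_cart_iff[of c]
    using inv[OF \<open>x \<in> U\<close>] by (auto simp: c_def invertible_det_nz)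
  then obtain c' where "(c has_derivative c') (at x)"
    by (auto simp: differentiable_def)
  \<comment> \<open>The Cramer quotient is explicit and hence visibly differentiable at
    \<open>x\<close>; its agreement with \<open>w\<close> on the open set \<open>U\<close> is enough
    to transfer the derivative.\<close>
  moreover have "c y = w y" if "y \<in> U" for y
    using cramer[of "G y" "w y" "b y"] inv[OF that] sol[OF that]
    by (simp add: c_def invertible_det_nz)
  ultimately have "(w has_derivative c') (at x)"
    using has_derivative_transform_within_open[OF _ \<open>open U\<close> \<open>x \<in> U\<close>] by blast
  then show ?thesis
    by (auto simp: differentiable_def)
qed

section \<open>Gradients and mixed derivatives as linear and bilinear forms\<close>

text \<open>Riesz representation, with basis coordinates \<open>f' b\<close>. It allows gradients to
  be compared by pairing them with an arbitrary direction \<open>h\<close>.\<close>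

lemma inner_gradient:
  fixes f :: "'a::euclidean_space \<Rightarrow> real"
  assumes "(f has_derivative f') (at x)"
  shows "inner h (gradient f x) = f' h"
proof -
  interpret linear f' using assms by (rule has_derivative_linear)
  define D where "D = (\<Sum>b\<in>Basis. f' b *\<^sub>R b)"
  have f': "f' h = inner h D" for h
  proof -
    have "f' h = f' (\<Sum>b\<in>Basis. inner h b *\<^sub>R b)"
      by (simp add: euclidean_representation)
    then show ?thesis
      by (simp add: sum scale D_def inner_sum_right mult.commute)
  qed
  then have "f' = (\<lambda>h. inner h D)" by auto
  with assms have "GDERIV f x :> D"
    by (simp add: gderiv_def)
  then have "gradient f x = D" by (rule gradient_eqI)
  with f' show ?thesis by simp
qed

lemma partial_deriv_eq:
  assumes "(f has_derivative f') (at x)"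
  shows "partial_deriv i f x = f' (axis i 1)"
proof -
  interpret linear f' using assms by (rule has_derivative_linear)
  have "((\<lambda>t. x + t *\<^sub>R axis i 1) has_derivative (\<lambda>t. t *\<^sub>R axis i 1)) (at (0::real))"
    by (auto intro!: derivative_eq_intros)
  from has_derivative_compose[OF this, of f f'] assms
  have "((\<lambda>t. f (x + t *\<^sub>R axis i 1)) has_derivative (\<lambda>t. t * f' (axis i 1))) (at 0)"
    by (simp add: scale)
  then have "((\<lambda>t. f (x + t *\<^sub>R axis i 1)) has_real_derivative f' (axis i 1)) (at 0)"
    by (simp add: has_field_derivative_def mult_commute_abs)
  then show ?thesis
    by (simp add: partial_deriv_def DERIV_imp_deriv)
qed

lemma continuously_differentiable_on_has_derivative_frechet:
  assumes "continuously_differentiable_on U f" "x \<in> U"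
  shows "(f has_derivative frechet_derivative f (at x)) (at x)"
proof -
  obtain f' where "(f has_derivative blinfun_apply (f' x)) (at x)"
    using assms unfolding continuously_differentiable_on_def by blast
  then show ?thesis
    using differentiableI frechet_derivative_works by blast
qed

lemma has_derivative_half_norm_squared:
  fixes g :: "'a::real_normed_vector \<Rightarrow> 'b::real_inner"
  assumes "(g has_derivative g') (at x within S)"
  shows "((\<lambda>x. 1/2 * (norm (g x))\<^sup>2) has_derivative (\<lambda>h. inner (g x) (g' h))) (at x within S)"
  unfolding power2_norm_eq_inner
  by (auto intro!: derivative_eq_intros assms simp: inner_commute)

lemma partial_deriv_f_lower:
  "partial_deriv j (\<lambda>w. f_lower M y w \<theta>) w = inner (M \<theta> *v axis j 1) (M \<theta> *v w - y \<theta>)"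
proof -
  have "((\<lambda>w. M \<theta> *v w - y \<theta>) has_derivative (\<lambda>h. M \<theta> *v h)) (at w)"
    by (auto intro!: derivative_eq_intros bounded_linear_imp_has_derivative
        matrix_vector_mul_bounded_linear)
  from has_derivative_half_norm_squared[OF this] show ?thesis
    by (simp add: f_lower_def partial_deriv_eq inner_commute)
qed

text \<open>Both sides are bilinear in \<open>h\<close> and \<open>v\<close>, so it suffices to
  compare them on coordinate vectors. There the product rule is applied to the explicit w-partials
  from \<open>partial_deriv_f_lower\<close>.\<close>

lemma inner_mixed_hessian:
  fixes M :: "real^'p \<Rightarrow> real^'n^'m"
  assumes M: "(M has_derivative M') (at \<theta>)" and y: "(y has_derivative y') (at \<theta>)"
  shows "inner h (mixed_hessian (f_lower M y) w \<theta> *v v)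
    = inner (M' h *v v) (M \<theta> *v w - y \<theta>) + inner (M \<theta> *v v) (M' h *v w - y' h)"
proof -
  define B where "B = (\<lambda>h v. inner (M' h *v v) (M \<theta> *v w - y \<theta>) + inner (M \<theta> *v v) (M' h *v w - y' h))"
  have entry: "mixed_hessian (f_lower M y) w \<theta> $ i $ j = B (axis i 1) (axis j 1)" for i j
  proof -
    have "((\<lambda>\<theta>. inner (M \<theta> *v axis j 1) (M \<theta> *v w - y \<theta>)) has_derivative
        (\<lambda>h. B h (axis j 1))) (at \<theta>)"
      unfolding B_def
      by (auto intro!: derivative_eq_intros has_derivative_matrix_vector_mult M y)
    then show ?thesis
      by (simp add: mixed_hessian_def partial_deriv_f_lower partial_deriv_eq)
  qed
  have linM: "linear M'" and liny: "linear y'"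
    using M y by (auto intro: has_derivative_linear)
  have lin1: "linear (\<lambda>h. B h v)" for v
    by (intro linearI) (simp_all add: B_def linear_add[OF linM] linear_add[OF liny]
        linear_scale[OF linM] linear_scale[OF liny] matrix_vector_mult_add_rdistrib
        inner_simps distrib_left right_diff_distrib flip: scaleR_matrix_vector_assoc)
  have lin2: "linear (B h)" for h
    by (intro linearI) (simp_all add: B_def matrix_vector_right_distrib matrix_vector_mult_scaleR
        inner_simps distrib_left right_diff_distrib)
  have sum_axis: "z = (\<Sum>i\<in>UNIV. z $ i *\<^sub>R axis i 1)" for z :: "real^'k"
    using basis_expansion[of z] by (simp add: scalar_mult_eq_scaleR)
  have "B h v = (\<Sum>i\<in>UNIV. h $ i * B (axis i 1) v)"
    by (subst sum_axis[of h]) (simp add: linear_sum[OF lin1] linear_scale[OF lin1])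
  also have "\<dots> = (\<Sum>i\<in>UNIV. h $ i * (\<Sum>j\<in>UNIV. v $ j * B (axis i 1) (axis j 1)))"
    by (subst sum_axis[of v]) (simp add: linear_sum[OF lin2] linear_scale[OF lin2])
  also have "\<dots> = inner h (mixed_hessian (f_lower M y) w \<theta> *v v)"
    by (simp add: inner_vec_def matrix_vector_mult_def entry mult.commute)
  finally show ?thesis
    by (simp add: B_def)
qed

section \<open>Implicit differentiation of the minimizer and elimination of its derivative\<close>

text \<open>Differentiability comes from the normal equation as a linear system whose coefficients
  are polynomials in the entries of \<open>M\<close> and \<open>y\<close>. The identity comes from
  differentiating the same equation, paired with a fixed \<open>v\<close>.\<close>

lemma w_hat_has_derivative:
  fixes M :: "real^'p \<Rightarrow> real^'n^'m"
  assumes "open U" "\<theta> \<in> U"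
    and M: "(M has_derivative M') (at \<theta>)" and y: "(y has_derivative y') (at \<theta>)"
    and rank: "\<And>\<theta>. \<theta> \<in> U \<Longrightarrow> full_column_rank (M \<theta>)"
  obtains w' where "(w_hat M y has_derivative w') (at \<theta>)"
    and "\<And>h v. inner h (mixed_hessian (f_lower M y) (w_hat M y \<theta>) \<theta> *v v)
      = - inner (M \<theta> *v v) (M \<theta> *v w' h)"
proof -
  have "M differentiable (at \<theta>)" "y differentiable (at \<theta>)"
    using M y by (auto simp: differentiable_def)
  then have Mij: "(\<lambda>x. M x $ i $ j) differentiable (at \<theta>)"
    and yi: "(\<lambda>x. y x $ i) differentiable (at \<theta>)" for i j
    by (simp_all add: differentiable_cart_iff[of M] differentiable_cart_iff[of y]
        differentiable_cart_iff[of "\<lambda>x. M x $ i" for i])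
  have "w_hat M y differentiable (at \<theta>)"
  proof (rule differentiable_linear_system_solution[OF \<open>open U\<close> \<open>\<theta> \<in> U\<close>])
    show "(\<lambda>x. (transpose (M x) ** M x) $ i $ j) differentiable (at \<theta>)" for i j
      unfolding matrix_matrix_mult_def transpose_def vec_lambda_beta
      by (intro differentiable_sum ballI differentiable_mult Mij) simp
    show "(\<lambda>x. (transpose (M x) *v y x) $ i) differentiable (at \<theta>)" for i
      unfolding matrix_vector_mult_def transpose_def vec_lambda_beta
      by (intro differentiable_sum ballI differentiable_mult Mij yi) simp
  qed (simp_all add: rank w_hat_eq_pinv normal_equation invertible_gram)
  then obtain w' where w': "(w_hat M y has_derivative w') (at \<theta>)"
    by (auto simp: differentiable_def)
  moreover have "inner h (mixed_hessian (f_lower M y) (w_hat M y \<theta>) \<theta> *v v)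
      = - inner (M \<theta> *v v) (M \<theta> *v w' h)" for h v
  proof -
    let ?w = "w_hat M y"
    let ?g = "\<lambda>x. inner (M x *v v) (M x *v ?w x - y x)"
    let ?g' = "\<lambda>h. inner (M' h *v v) (M \<theta> *v ?w \<theta> - y \<theta>)
      + inner (M \<theta> *v v) (M \<theta> *v w' h + M' h *v ?w \<theta> - y' h)"
    have "?g x = 0" if "x \<in> U" for x
      using normal_equation(2)[OF rank[OF that]]
      by (simp add: inner_matrix_vector_mult w_hat_eq_pinv rank that)
    then have "(?g has_derivative (\<lambda>_. 0)) (at \<theta>)"
      by (intro has_derivative_transform_within_open[OF has_derivative_const[of 0]
            \<open>open U\<close> \<open>\<theta> \<in> U\<close>]) auto
    moreover have "(?g has_derivative ?g') (at \<theta>)"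
      by (auto intro!: derivative_eq_intros has_derivative_matrix_vector_mult M y w')
    ultimately have "(\<lambda>_. 0) = ?g'"
      by (rule has_derivative_unique)
    \<comment> \<open>The terms with \<open>M'\<close> and \<open>y'\<close> form the mixed Hessian
      expression of \<open>inner_mixed_hessian\<close>; the only other term is
      \<open>inner (M \<theta> *v v) (M \<theta> *v w' h)\<close>.\<close>
    then have "?g' h = 0" by (simp only: fun_eq_iff)
    then show ?thesis
      unfolding inner_mixed_hessian[OF M y] by (simp add: inner_simps)
  qed
  ultimately show ?thesis by (rule that)
qed

text \<open>The Gram matrix is symmetric, so the transpose of its inverse is again its
  inverse.\<close>

lemma gram_mult_transpose_Gamma:
  assumes "full_column_rank (M\<^sub>L \<theta>)"
  shows "(transpose (M\<^sub>L \<theta>) ** M\<^sub>L \<theta>) *v (transpose (Gamma_mat M\<^sub>L M\<^sub>U \<theta>) *v r)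
    = transpose (M\<^sub>U \<theta>) *v r"
proof -
  let ?G = "transpose (M\<^sub>L \<theta>) ** M\<^sub>L \<theta>"
  have "?G ** transpose (matrix_inv ?G) = transpose (matrix_inv ?G ** ?G)"
    by (simp add: matrix_transpose_mul)
  then have "?G ** transpose (matrix_inv ?G) = mat 1"
    by (simp add: matrix_inv_mult[OF invertible_gram[OF assms]])
  then show ?thesis
    by (simp add: Gamma_mat_def matrix_transpose_mul matrix_vector_mul_assoc matrix_mul_assoc)
qed

text \<open>Stated for a moving \<open>w\<close> to serve twice: with the minimizer it gives the
  total derivative, with a constant \<open>w\<close> the partial one.\<close>

lemma f_upper_has_derivative:
  fixes M :: "real^'p \<Rightarrow> real^'n^'m"
  assumes "(M has_derivative M') (at \<theta>)" "(y has_derivative y') (at \<theta>)"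
    and "(R has_derivative R') (at \<theta>)" "(w has_derivative w') (at \<theta>)"
  shows "((\<lambda>x. f_upper M y \<mu> R (w x) x) has_derivative
    (\<lambda>h. inner (M \<theta> *v w \<theta> - y \<theta>) (M \<theta> *v w' h + M' h *v w \<theta> - y' h) + \<mu>/2 * R' h)) (at \<theta>)"
  unfolding f_upper_def
  by (intro has_derivative_add has_derivative_half_norm_squared has_derivative_diff
      has_derivative_matrix_vector_mult has_derivative_mult_right assms)

text \<open>Only the adjoint solution \<open>v = \<Gamma>\<^sup>T r\<close>, which satisfies \<open>M\<^sub>L\<^sup>T M\<^sub>L v = M\<^sub>U\<^sup>T r\<close> for the upper
  residual \<open>r\<close>, is needed to eliminate the derivative \<open>w'\<close> of the minimizer from the chain rule:
  \<open>r \<bullet> M\<^sub>U w' h = v \<bullet> M\<^sub>L\<^sup>T M\<^sub>L w' h\<close>, and the right-hand side is known from differentiating the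
  normal equation.\<close>

lemma gradient_f_hat:
  fixes M\<^sub>L M\<^sub>U :: "real^'p \<Rightarrow> real^'n^'m"
  assumes "open U" "\<theta> \<in> U"
    and dML: "(M\<^sub>L has_derivative M\<^sub>L') (at \<theta>)" and dyL: "(y\<^sub>L has_derivative y\<^sub>L') (at \<theta>)"
    and dMU: "(M\<^sub>U has_derivative M\<^sub>U') (at \<theta>)" and dyU: "(y\<^sub>U has_derivative y\<^sub>U') (at \<theta>)"
    and dR: "(R has_derivative R') (at \<theta>)"
    and rank: "\<And>\<theta>. \<theta> \<in> U \<Longrightarrow> full_column_rank (M\<^sub>L \<theta>)"
  shows "f_hat M\<^sub>L y\<^sub>L M\<^sub>U y\<^sub>U \<mu> R differentiable (at \<theta>)"
    and "gradient (f_hat M\<^sub>L y\<^sub>L M\<^sub>U y\<^sub>U \<mu> R) \<theta> =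
      gradient (f_upper M\<^sub>U y\<^sub>U \<mu> R (w_hat M\<^sub>L y\<^sub>L \<theta>)) \<theta>
      - mixed_hessian (f_lower M\<^sub>L y\<^sub>L) (w_hat M\<^sub>L y\<^sub>L \<theta>) \<theta> *v
          (transpose (Gamma_mat M\<^sub>L M\<^sub>U \<theta>) *v (M\<^sub>U \<theta> *v w_hat M\<^sub>L y\<^sub>L \<theta> - y\<^sub>U \<theta>))"
proof -
  obtain w' where w': "(w_hat M\<^sub>L y\<^sub>L has_derivative w') (at \<theta>)"
    and hess: "\<And>h v. inner h (mixed_hessian (f_lower M\<^sub>L y\<^sub>L) (w_hat M\<^sub>L y\<^sub>L \<theta>) \<theta> *v v)
      = - inner (M\<^sub>L \<theta> *v v) (M\<^sub>L \<theta> *v w' h)"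
    using w_hat_has_derivative[OF assms(1,2) dML dyL rank] by blast
  define w where "w = w_hat M\<^sub>L y\<^sub>L \<theta>"
  define r where "r = M\<^sub>U \<theta> *v w - y\<^sub>U \<theta>"
  define v where "v = transpose (Gamma_mat M\<^sub>L M\<^sub>U \<theta>) *v r"
  define H where "H = mixed_hessian (f_lower M\<^sub>L y\<^sub>L) w \<theta>"
  have hat: "(f_hat M\<^sub>L y\<^sub>L M\<^sub>U y\<^sub>U \<mu> R has_derivative
      (\<lambda>h. inner r (M\<^sub>U \<theta> *v w' h + M\<^sub>U' h *v w - y\<^sub>U' h) + \<mu>/2 * R' h)) (at \<theta>)"
    unfolding f_hat_def[abs_def] w_def r_def by (rule f_upper_has_derivative[OF dMU dyU dR w'])
  then show "f_hat M\<^sub>L y\<^sub>L M\<^sub>U y\<^sub>U \<mu> R differentiable (at \<theta>)"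
    by (auto simp: differentiable_def)
  \<comment> \<open>The derivative 0 of the constant \<open>w\<close> is left visible, so that
    \<open>hat\<close> and \<open>up\<close> differ only in \<open>w' h\<close> against 0.\<close>
  have up: "(f_upper M\<^sub>U y\<^sub>U \<mu> R w has_derivative
      (\<lambda>h. inner r (M\<^sub>U \<theta> *v 0 + M\<^sub>U' h *v w - y\<^sub>U' h) + \<mu>/2 * R' h)) (at \<theta>)"
    unfolding r_def by (rule f_upper_has_derivative[OF dMU dyU dR has_derivative_const])
  have "inner r (M\<^sub>U \<theta> *v w' h) = - inner h (H *v v)" for h
  proof -
    have "inner r (M\<^sub>U \<theta> *v w' h) = inner (w' h) (transpose (M\<^sub>U \<theta>) *v r)"
      by (metis inner_commute inner_matrix_vector_mult)
    also have "\<dots> = inner (w' h) ((transpose (M\<^sub>L \<theta>) ** M\<^sub>L \<theta>) *v v)"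
      by (simp only: v_def gram_mult_transpose_Gamma[of M\<^sub>L \<theta> M\<^sub>U r, OF rank[OF \<open>\<theta> \<in> U\<close>]])
    also have "\<dots> = inner (M\<^sub>L \<theta> *v v) (M\<^sub>L \<theta> *v w' h)"
      by (metis inner_commute inner_matrix_vector_mult matrix_vector_mul_assoc)
    finally show ?thesis
      by (simp add: hess H_def w_def)
  qed
  then have "inner h (gradient (f_hat M\<^sub>L y\<^sub>L M\<^sub>U y\<^sub>U \<mu> R) \<theta>)
      = inner h (gradient (f_upper M\<^sub>U y\<^sub>U \<mu> R w) \<theta> - H *v v)" for h
    by (simp add: inner_simps inner_gradient[OF hat] inner_gradient[OF up])
  then show "gradient (f_hat M\<^sub>L y\<^sub>L M\<^sub>U y\<^sub>U \<mu> R) \<theta> =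
      gradient (f_upper M\<^sub>U y\<^sub>U \<mu> R (w_hat M\<^sub>L y\<^sub>L \<theta>)) \<theta>
      - mixed_hessian (f_lower M\<^sub>L y\<^sub>L) (w_hat M\<^sub>L y\<^sub>L \<theta>) \<theta> *v
          (transpose (Gamma_mat M\<^sub>L M\<^sub>U \<theta>) *v (M\<^sub>U \<theta> *v w_hat M\<^sub>L y\<^sub>L \<theta> - y\<^sub>U \<theta>))"
    unfolding H_def v_def r_def w_def by (metis vector_eq_ldot)
qed

theorem mainTheorem2:
  fixes U :: "(real^'p) set"
    and M\<^sub>L M\<^sub>U :: "real^'p \<Rightarrow> real^'n^'m"
    and y\<^sub>L y\<^sub>U :: "real^'p \<Rightarrow> real^'m"
    and R :: "real^'p \<Rightarrow> real"
    and \<mu> :: real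
  assumes "open U"
    and "continuously_differentiable_on U M\<^sub>L" "continuously_differentiable_on U M\<^sub>U"
    and "continuously_differentiable_on U y\<^sub>L" "continuously_differentiable_on U y\<^sub>U"
    and "R differentiable_on U"
    and "\<mu> \<ge> 0"
    and "\<And>\<theta>. \<theta> \<in> U \<Longrightarrow> full_column_rank (M\<^sub>L \<theta>)"
    and "\<And>\<theta>. \<theta> \<in> U \<Longrightarrow> full_column_rank (M\<^sub>U \<theta>)"
  shows "(\<forall>\<theta>\<in>U. {w. is_arg_min (\<lambda>w. f_lower M\<^sub>L y\<^sub>L w \<theta>) (\<lambda>_. True) w} = {w_hat M\<^sub>L y\<^sub>L \<theta>}
             \<and> w_hat M\<^sub>L y\<^sub>L \<theta> = pinv (M\<^sub>L \<theta>) *v y\<^sub>L \<theta>)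
       \<and> f_hat M\<^sub>L y\<^sub>L M\<^sub>U y\<^sub>U \<mu> R differentiable_on U
       \<and> (\<forall>\<theta>\<in>U.
            gradient (f_hat M\<^sub>L y\<^sub>L M\<^sub>U y\<^sub>U \<mu> R) \<theta> =
              gradient (\<lambda>\<theta>'. f_upper M\<^sub>U y\<^sub>U \<mu> R (w_hat M\<^sub>L y\<^sub>L \<theta>) \<theta>') \<theta>
              - mixed_hessian (f_lower M\<^sub>L y\<^sub>L) (w_hat M\<^sub>L y\<^sub>L \<theta>) \<theta> *v
                  (transpose (Gamma_mat M\<^sub>L M\<^sub>U \<theta>) *v
                     (M\<^sub>U \<theta> *v (pinv (M\<^sub>L \<theta>) *v y\<^sub>L \<theta>) - y\<^sub>U \<theta>)))
       \<and> ((\<forall>\<theta>\<in>U. M\<^sub>L \<theta> = M\<^sub>U \<theta> \<and> y\<^sub>L \<theta> = y\<^sub>U \<theta>) \<longrightarrow>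
            (\<forall>\<theta>\<in>U.
               transpose (Gamma_mat M\<^sub>L M\<^sub>U \<theta>) *v
                 (M\<^sub>U \<theta> *v (pinv (M\<^sub>L \<theta>) *v y\<^sub>L \<theta>) - y\<^sub>U \<theta>) = 0
             \<and> gradient (f_hat M\<^sub>L y\<^sub>L M\<^sub>U y\<^sub>U \<mu> R) \<theta> =
                 gradient (\<lambda>\<theta>'. f_upper M\<^sub>U y\<^sub>U \<mu> R (w_hat M\<^sub>L y\<^sub>L \<theta>) \<theta>') \<theta>))"
proof (intro conjI ballI impI)
  have rank: "\<And>\<theta>. \<theta> \<in> U \<Longrightarrow> full_column_rank (M\<^sub>L \<theta>)" by fact
  show w_hat: "w_hat M\<^sub>L y\<^sub>L \<theta> = pinv (M\<^sub>L \<theta>) *v y\<^sub>L \<theta>" if "\<theta> \<in> U" for \<theta>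
    using rank[OF that] by (rule w_hat_eq_pinv)
  show "{w. is_arg_min (\<lambda>w. f_lower M\<^sub>L y\<^sub>L w \<theta>) (\<lambda>_. True) w} = {w_hat M\<^sub>L y\<^sub>L \<theta>}"
    if "\<theta> \<in> U" for \<theta>
    using rank[OF that] by (auto simp: is_arg_min_f_lower_iff w_hat[OF that])
  have main: "f_hat M\<^sub>L y\<^sub>L M\<^sub>U y\<^sub>U \<mu> R differentiable (at \<theta>)"
    "gradient (f_hat M\<^sub>L y\<^sub>L M\<^sub>U y\<^sub>U \<mu> R) \<theta> =
      gradient (f_upper M\<^sub>U y\<^sub>U \<mu> R (w_hat M\<^sub>L y\<^sub>L \<theta>)) \<theta>
      - mixed_hessian (f_lower M\<^sub>L y\<^sub>L) (w_hat M\<^sub>L y\<^sub>L \<theta>) \<theta> *v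
          (transpose (Gamma_mat M\<^sub>L M\<^sub>U \<theta>) *v (M\<^sub>U \<theta> *v w_hat M\<^sub>L y\<^sub>L \<theta> - y\<^sub>U \<theta>))"
    if "\<theta> \<in> U" for \<theta>
  proof -
    have dR: "(R has_derivative frechet_derivative R (at \<theta>)) (at \<theta>)"
      using assms(6) \<open>\<theta> \<in> U\<close> unfolding differentiable_on_eq_differentiable_at[OF \<open>open U\<close>]
      by (simp flip: frechet_derivative_works)
    note derivs = assms(2,4,3,5)[THEN continuously_differentiable_on_has_derivative_frechet,
        OF \<open>\<theta> \<in> U\<close>]
    note gradient_f_hat = gradient_f_hat[OF \<open>open U\<close> \<open>\<theta> \<in> U\<close> derivs dR rank]
    show "f_hat M\<^sub>L y\<^sub>L M\<^sub>U y\<^sub>U \<mu> R differentiable (at \<theta>)"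
      by (rule gradient_f_hat(1))
    show "gradient (f_hat M\<^sub>L y\<^sub>L M\<^sub>U y\<^sub>U \<mu> R) \<theta> =
        gradient (f_upper M\<^sub>U y\<^sub>U \<mu> R (w_hat M\<^sub>L y\<^sub>L \<theta>)) \<theta>
        - mixed_hessian (f_lower M\<^sub>L y\<^sub>L) (w_hat M\<^sub>L y\<^sub>L \<theta>) \<theta> *v
            (transpose (Gamma_mat M\<^sub>L M\<^sub>U \<theta>) *v (M\<^sub>U \<theta> *v w_hat M\<^sub>L y\<^sub>L \<theta> - y\<^sub>U \<theta>))"
      by (rule gradient_f_hat(2))
  qed
  show "f_hat M\<^sub>L y\<^sub>L M\<^sub>U y\<^sub>U \<mu> R differentiable_on U"
    using main(1) by (simp add: differentiable_on_eq_differentiable_at[OF \<open>open U\<close>])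
  show gradient: "gradient (f_hat M\<^sub>L y\<^sub>L M\<^sub>U y\<^sub>U \<mu> R) \<theta> =
      gradient (\<lambda>\<theta>'. f_upper M\<^sub>U y\<^sub>U \<mu> R (w_hat M\<^sub>L y\<^sub>L \<theta>) \<theta>') \<theta>
      - mixed_hessian (f_lower M\<^sub>L y\<^sub>L) (w_hat M\<^sub>L y\<^sub>L \<theta>) \<theta> *v
          (transpose (Gamma_mat M\<^sub>L M\<^sub>U \<theta>) *v
             (M\<^sub>U \<theta> *v (pinv (M\<^sub>L \<theta>) *v y\<^sub>L \<theta>) - y\<^sub>U \<theta>))"
    if "\<theta> \<in> U" for \<theta>
    using main(2)[OF that] by (simp add: w_hat[OF that])
  assume same: "\<forall>\<theta>\<in>U. M\<^sub>L \<theta> = M\<^sub>U \<theta> \<and> y\<^sub>L \<theta> = y\<^sub>U \<theta>"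
  \<comment> \<open>The last factor of \<Gamma>^T is now \<open>M\<^sub>L\<close>^T, which
    annihilates the lower-level residual.\<close>
  show zero: "transpose (Gamma_mat M\<^sub>L M\<^sub>U \<theta>) *v
      (M\<^sub>U \<theta> *v (pinv (M\<^sub>L \<theta>) *v y\<^sub>L \<theta>) - y\<^sub>U \<theta>) = 0" if "\<theta> \<in> U" for \<theta>
    using normal_equation(2)[OF rank[OF that], of "y\<^sub>U \<theta>"] same that
    by (simp add: Gamma_mat_def matrix_transpose_mul flip: matrix_vector_mul_assoc)
  show "gradient (f_hat M\<^sub>L y\<^sub>L M\<^sub>U y\<^sub>U \<mu> R) \<theta> =
      gradient (\<lambda>\<theta>'. f_upper M\<^sub>U y\<^sub>U \<mu> R (w_hat M\<^sub>L y\<^sub>L \<theta>) \<theta>') \<theta>" if "\<theta> \<in> U" for \<theta>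
    using gradient[OF that] unfolding zero[OF that] by simp
qed

end
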